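(* Let $X$ be an infinite-dimensional real separable Hilbert space of functions over a domain $D\subset\mathbb{R}^d$ ($d\in\{1,2,3\}$), let $\mathcal{A}$ be a Laplacian-like operator on $X$ (see context), let $\alpha>d/2$, and let $\mathcal{C}_0=\mathcal{A}^{-\alpha}$ be the Gaussian prior covariance operator. Let $H_{\text{misfit}}:X\to X$ be the Hessian of the data misfit at the MAP point, and let $$\mathcal{C}_1=\left(H_{\text{misfit}}+\mathcal{C}_0^{-1}\right)^{-1}$$ be the Gaussian posterior covariance operator. Let $(\lambda_j^0)_{j\ge1}$ and $(\lambda_j^1)_{j\ge1}$ denote the non-increasing sequences of eigenvalues (repeated according to multiplicity) of $\mathcal{C}_0$ and $\mathcal{C}_1$, respectively. If $H_{\text{misfit}}$ is positive semi-definite, then $$0\le\lambda_j^1\le\lambda_j^0\qquad\text{for all } j\ge1 .$$ Moreover, $(\lambda_j^1)_{j\ge1}\in\ell^q$ for every $q>\frac{d}{2\alpha}$.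
   Context: Laplacian-like operator: $\mathcal{A}$ is a (densely defined, unbounded) positive definite, self-adjoint, invertible operator on $X$ with eigenpairs $\{(\lambda_j,\psi_j)\}_{j\ge1}$, where $(\psi_j)_{j\ge1}$ is an orthonormal basis of $X$ and the eigenvalues $\lambda_j$ (listed in non-decreasing order) grow asymptotically as $j^{2/d}$ (i.e. $\lambda_j$ is bounded above and below by positive constant multiples of $j^{2/d}$), so that $(\lambda_j^{-1})_{j\ge1}\in\ell^q$ for all $q>d/2$. The power $\mathcal{A}^{-\alpha}$ is defined spectrally: $\mathcal{A}^{-\alpha}\psi_j=\lambda_j^{-\alpha}\psi_j$. Hessian misfit: $H_{\text{misfit}}=D_m^2\Phi(m)|_{m=m_1}$ is the second (Fréchet) derivative, identified with a bounded self-adjoint operator on $X$, of the negative log-likelihood $\Phi(m)=\frac12\|y-\mathcal{G}(m)\|^2_{\Gamma_{\text{noise}}}$ at the MAP point $m_1$; here $\mathcal{G}$ is the parameter-to-observable map, $y$ the data, and $\|v\|^2_{\Gamma_{\text{noise}}}=\langle v,\Gamma_{\text{noise}}^{-1}v\rangle$ with $\Gamma_{\text{noise}}$ the noise covariance. For the purposes of the statement, $H_{\text{misfit}}$ is a bounded self-adjoint operator on $X$. Positive semi-definite means $\langle v,H_{\text{misfit}}v\rangle\ge0$ for all $v\in X$. $\mathcal{C}_1$ is the bounded inverse of the operator $H_{\text{misfit}}+\mathcal{C}_0^{-1}$ with domain that of $\mathcal{C}_0^{-1}$. *)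

theory Defs
  imports "HOL-Analysis.Analysis"
begin

text \<open>
  A possibly unbounded operator on a Hilbert space is given by its domain \<open>D\<close> and a total
  function \<open>T\<close>, of which only the values on \<open>D\<close> are meaningful.
\<close>

definition densely_defined :: "'a::real_inner set \<Rightarrow> ('a \<Rightarrow> 'a) \<Rightarrow> bool" where
  "densely_defined D T \<longleftrightarrow>
     subspace D \<and> closure D = UNIV \<and>
     (\<forall>u\<in>D. \<forall>v\<in>D. T (u + v) = T u + T v) \<and>
     (\<forall>c. \<forall>u\<in>D. T (c *\<^sub>R u) = c *\<^sub>R T u)"

text \<open>
  The pair \<open>(v, w)\<close> lies in the graph of the adjoint iff \<open>T u \<bullet> v = u \<bullet> w\<close> for all \<open>u \<in> D\<close>;
  self-adjointness says that this graph (hence also the domain of the adjoint) is that of \<open>T\<close>.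
\<close>

definition self_adjoint :: "'a::real_inner set \<Rightarrow> ('a \<Rightarrow> 'a) \<Rightarrow> bool" where
  "self_adjoint D T \<longleftrightarrow>
     densely_defined D T \<and>
     (\<forall>v w. (\<forall>u\<in>D. T u \<bullet> v = u \<bullet> w) \<longleftrightarrow> v \<in> D \<and> T v = w)"

definition positive_definite :: "'a::real_inner set \<Rightarrow> ('a \<Rightarrow> 'a) \<Rightarrow> bool" where
  "positive_definite D T \<longleftrightarrow> (\<forall>u\<in>D. u \<noteq> 0 \<longrightarrow> 0 < u \<bullet> T u)"

definition positive_semidefinite :: "('a::real_inner \<Rightarrow> 'a) \<Rightarrow> bool" where
  "positive_semidefinite T \<longleftrightarrow> (\<forall>v. 0 \<le> v \<bullet> T v)"

definition bounded_inverse ::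
    "'a::real_inner set \<Rightarrow> ('a \<Rightarrow> 'a) \<Rightarrow> ('a \<Rightarrow> 'a) \<Rightarrow> bool" where
  "bounded_inverse D T S \<longleftrightarrow>
     bounded_linear S \<and> (\<forall>v. S v \<in> D \<and> T (S v) = v) \<and> (\<forall>u\<in>D. S (T u) = u)"

definition orthonormal_basis :: "(nat \<Rightarrow> 'a::real_inner) \<Rightarrow> bool" where
  "orthonormal_basis \<psi> \<longleftrightarrow>
     (\<forall>i j. \<psi> i \<bullet> \<psi> j = (if i = j then 1 else 0)) \<and> closure (span (range \<psi>)) = UNIV"

text \<open>
  Sequences are indexed from 0, so the index \<open>j \<ge> 1\<close> of the mathematical notation is \<open>Suc j\<close>.
  Unboundedness of \<open>A\<close> and positivity of the eigenvalues follow from the growth condition.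
\<close>

definition laplacian_like ::
    "nat \<Rightarrow> 'a::real_inner set \<Rightarrow> ('a \<Rightarrow> 'a) \<Rightarrow> (nat \<Rightarrow> real) \<Rightarrow> (nat \<Rightarrow> 'a) \<Rightarrow> bool" where
  "laplacian_like d D A lam \<psi> \<longleftrightarrow>
     self_adjoint D A \<and> positive_definite D A \<and> (\<exists>S. bounded_inverse D A S) \<and>
     orthonormal_basis \<psi> \<and> (\<forall>j. \<psi> j \<in> D \<and> A (\<psi> j) = lam j *\<^sub>R \<psi> j) \<and>
     incseq lam \<and>
     (\<exists>c>0. \<exists>C>0. \<forall>j. c * real (Suc j) powr (2 / real d) \<le> lam j \<and>
                       lam j \<le> C * real (Suc j) powr (2 / real d))"

definition spectral_power ::
    "(nat \<Rightarrow> real) \<Rightarrow> (nat \<Rightarrow> 'a::real_inner) \<Rightarrow> real \<Rightarrow> 'a \<Rightarrow> 'a" where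
  "spectral_power lam \<psi> s v = (\<Sum>j. (lam j powr s * (\<psi> j \<bullet> v)) *\<^sub>R \<psi> j)"

lemma spectral_power_basis:
  assumes "orthonormal_basis \<psi>"
  shows "spectral_power lam \<psi> s (\<psi> k) = lam k powr s *\<^sub>R \<psi> k"
proof -
  have "spectral_power lam \<psi> s (\<psi> k) = (\<Sum>j\<in>{k}. (lam j powr s * (\<psi> j \<bullet> \<psi> k)) *\<^sub>R \<psi> j)"
    unfolding spectral_power_def using assms
    by (intro suminf_finite) (auto simp: orthonormal_basis_def)
  then show ?thesis
    using assms by (simp add: orthonormal_basis_def)
qed

definition eigenspace :: "('a::real_vector \<Rightarrow> 'a) \<Rightarrow> real \<Rightarrow> 'a set" where
  "eigenspace T x = {v. T v = x *\<^sub>R v}"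

text \<open>
  The non-increasing enumeration of all eigenvalues, repeated according to multiplicity: every
  real \<open>x\<close> occurs exactly as often as the dimension of its eigenspace (not at all if \<open>x\<close> is no
  eigenvalue). The notion is meant for injective compact positive operators on an
  infinite-dimensional space; in particular 0 is then not an eigenvalue. Finite
  dimensionality is stated separately since \<open>dim\<close> is 0 on infinite-dimensional spaces.
\<close>

definition eigenvalue_sequence :: "('a::real_vector \<Rightarrow> 'a) \<Rightarrow> (nat \<Rightarrow> real) \<Rightarrow> bool" where
  "eigenvalue_sequence T \<mu> \<longleftrightarrow>
     decseq \<mu> \<and>
     (\<forall>x. (\<exists>B. finite B \<and> eigenspace T x \<subseteq> span B) \<and>
          finite {j. \<mu> j = x} \<and> card {j. \<mu> j = x} = dim (eigenspace T x))"

end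

theory Submission
  imports Defs
begin

text \<open>
  Write \<open>\<nu> j = lam j powr (- \<alpha>)\<close> for the eigenvalue of \<open>C0\<close> at \<open>\<psi> j\<close>; these numbers decrease to 0.
  The proof bounds \<open>\<mu>1 j\<close> by \<open>\<nu> j\<close> and \<open>\<nu> j\<close> by \<open>\<mu>0 j\<close>.

  Adding the positive semi-definite \<open>H\<close> to the precision operator can only shrink the covariance:
  \<open>v \<bullet> C1 v \<le> v \<bullet> C0 v\<close> for all \<open>v\<close> (\<open>posterior_covariance\<close>). With \<open>z\<close> defined
  by \<open>C0 z = C1 v\<close>, so that \<open>v = H (C1 v) + z\<close>, this follows from nonnegativity of the form of
  \<open>C0\<close> at \<open>v - z\<close>.

  The bound \<open>\<mu>1 j \<le> \<nu> j\<close> is one half of the Courant-Fischer min-max principle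
  (\<open>eigenvalue_sequence_le\<close>). Orthogonal eigenvectors of \<open>C1\<close> for its \<open>j + 1\<close> largest eigenvalues
  span a space on which the form of \<open>C1\<close> is at least \<open>\<mu>1 j\<close> times the squared norm. By dimension,
  that space contains a nonzero \<open>v\<close> orthogonal to \<open>\<psi> 0, \<dots>, \<psi> (j - 1)\<close>, and at such a \<open>v\<close>
  the form of \<open>C0\<close>, hence that of \<open>C1\<close>, is at most \<open>\<nu> j\<close> times the squared norm.

  The bound \<open>\<nu> j \<le> \<mu>0 j\<close> is a counting argument (\<open>eigenvalue_sequence_ge\<close>): the \<open>\<psi> i\<close> with
  \<open>\<nu> i = x\<close> are linearly independent in the eigenspace for \<open>x\<close>, whose dimension is the number of
  occurrences of \<open>x\<close> in \<open>\<mu>0\<close>.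

  Finally, \<open>\<mu>1 j \<le> \<nu> j\<close> and the growth \<open>lam j \<ge> c (j + 1) powr (2 / d)\<close> dominate the series of
  \<open>\<mu>1 j powr q\<close> by a multiple of a \<open>p\<close>-series with exponent \<open>2 \<alpha> q / d > 1\<close>.
\<close>

section \<open>Diagonal operators in an orthonormal basis\<close>

lemma orthonormal_basis_inner:
  "orthonormal_basis \<psi> \<Longrightarrow> \<psi> i \<bullet> \<psi> j = (if i = j then 1 else 0)"
  by (simp add: orthonormal_basis_def)

lemma orthonormal_basis_inj:
  assumes "orthonormal_basis \<psi>"
  shows "inj \<psi>"
proof (rule injI)
  fix i j assume "\<psi> i = \<psi> j"
  then show "i = j"
    using orthonormal_basis_inner[OF assms, of i j] orthonormal_basis_inner[OF assms, of j j]
    by (auto split: if_splits)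
qed

lemma orthonormal_basis_independent:
  assumes "orthonormal_basis \<psi>"
  shows "independent (\<psi> ` S)"
proof (rule pairwise_orthogonal_independent)
  show "pairwise orthogonal (\<psi> ` S)"
    by (auto simp: pairwise_def orthogonal_def orthonormal_basis_inner[OF assms])
  show "0 \<notin> \<psi> ` S"
  proof
    assume "0 \<in> \<psi> ` S"
    then obtain i where "\<psi> i = 0" by auto
    then show False using orthonormal_basis_inner[OF assms, of i i] by simp
  qed
qed

lemma norm_orthonormal_combination:
  assumes "orthonormal_basis \<psi>" "finite S"
  shows "(norm (\<Sum>i\<in>S. a i *\<^sub>R \<psi> i))\<^sup>2 = (\<Sum>i\<in>S. (a i)\<^sup>2)"
proof -
  have "(norm (\<Sum>i\<in>S. a i *\<^sub>R \<psi> i))\<^sup>2 = (\<Sum>i\<in>S. (norm (a i *\<^sub>R \<psi> i))\<^sup>2)"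
    using assms(2)
    by (intro norm_sum_Pythagorean)
       (auto simp: pairwise_def orthogonal_def orthonormal_basis_inner[OF assms(1)])
  also have "\<dots> = (\<Sum>i\<in>S. (a i)\<^sup>2)"
    by (intro sum.cong)
       (simp_all add: power_mult_distrib power2_norm_eq_inner orthonormal_basis_inner[OF assms(1)])
  finally show ?thesis .
qed

text \<open>The difference of the two sides is the squared distance of \<open>v\<close> to its projection \<open>p\<close>.\<close>

lemma Bessel_inequality_finite:
  assumes "orthonormal_basis \<psi>" "finite S"
  shows "(\<Sum>i\<in>S. (\<psi> i \<bullet> v)\<^sup>2) \<le> v \<bullet> v"
proof -
  define p where "p = (\<Sum>i\<in>S. (\<psi> i \<bullet> v) *\<^sub>R \<psi> i)"
  have pp: "p \<bullet> p = (\<Sum>i\<in>S. (\<psi> i \<bullet> v)\<^sup>2)"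
    using norm_orthonormal_combination[OF assms] by (simp add: p_def power2_norm_eq_inner)
  have pv: "p \<bullet> v = (\<Sum>i\<in>S. (\<psi> i \<bullet> v)\<^sup>2)"
    by (simp add: p_def inner_sum_left power2_eq_square)
  have "0 \<le> (v - p) \<bullet> (v - p)" by simp
  then show ?thesis using pp pv by (simp add: inner_diff inner_commute)
qed

lemma Bessel_inequality:
  assumes "orthonormal_basis \<psi>"
  shows "summable (\<lambda>i. (\<psi> i \<bullet> v)\<^sup>2)" "(\<Sum>i. (\<psi> i \<bullet> v)\<^sup>2) \<le> v \<bullet> v"
proof -
  show s: "summable (\<lambda>i. (\<psi> i \<bullet> v)\<^sup>2)"
    by (rule bounded_imp_summable[where B = "v \<bullet> v"])
       (auto intro: Bessel_inequality_finite[OF assms])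
  show "(\<Sum>i. (\<psi> i \<bullet> v)\<^sup>2) \<le> v \<bullet> v"
    by (rule suminf_le_const[OF s]) (auto intro: Bessel_inequality_finite[OF assms])
qed

text \<open>
  The series defining the spectral power has orthogonal terms, so by Pythagoras its blocks have the
  squared norms of blocks of a numerical series, which converges by Bessel's inequality because the
  multipliers are bounded by the first one. All further properties of the operator are read off
  from this series term by term. The Cauchy criterion is applied to the partial sums directly
  because the sort of \<open>'a\<close> yields completeness but not the class \<open>banach\<close>.
\<close>

lemma spectral_power_sums:
  fixes \<psi> :: "nat \<Rightarrow> 'a::{real_inner, polish_space}"
  assumes onb: "orthonormal_basis \<psi>" and dec: "decseq (\<lambda>j. lam j powr s)"
  shows "(\<lambda>j. (lam j powr s * (\<psi> j \<bullet> v)) *\<^sub>R \<psi> j) sums spectral_power lam \<psi> s v"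
proof -
  define a where "a j = lam j powr s * (\<psi> j \<bullet> v)" for j
  have "(a j)\<^sup>2 \<le> (lam 0 powr s)\<^sup>2 * (\<psi> j \<bullet> v)\<^sup>2" for j
    using decseqD[OF dec, of 0 j]
    by (auto simp: a_def power_mult_distrib intro!: mult_right_mono power_mono)
  then have "summable (\<lambda>j. (a j)\<^sup>2)"
    by (intro summable_comparison_test'[OF summable_mult[OF Bessel_inequality(1)[OF onb]]])
       auto
  then have cau: "\<exists>N. \<forall>m\<ge>N. \<forall>n. norm (\<Sum>j\<in>{m..<n}. (a j)\<^sup>2) < e" if "e > 0" for e :: real
    using that by (simp add: summable_Cauchy)
  have "Cauchy (\<lambda>n. \<Sum>j<n. a j *\<^sub>R \<psi> j)"
  proof (rule CauchyI')
    fix e :: real assume "e > 0"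
    then obtain N where N: "\<And>m n. m \<ge> N \<Longrightarrow> norm (\<Sum>j\<in>{m..<n}. (a j)\<^sup>2) < e\<^sup>2"
      using cau[of "e\<^sup>2"] by auto
    have "norm ((\<Sum>j<m. a j *\<^sub>R \<psi> j) - (\<Sum>j<n. a j *\<^sub>R \<psi> j)) < e" if "m \<ge> N" "n > m" for m n
    proof -
      have "(\<Sum>j<n. a j *\<^sub>R \<psi> j) - (\<Sum>j<m. a j *\<^sub>R \<psi> j) = (\<Sum>j\<in>{m..<n}. a j *\<^sub>R \<psi> j)"
        using sum_diff_nat_ivl[of 0 m n "\<lambda>j. a j *\<^sub>R \<psi> j"] that
        by (simp add: lessThan_atLeast0)
      then have "(norm ((\<Sum>j<m. a j *\<^sub>R \<psi> j) - (\<Sum>j<n. a j *\<^sub>R \<psi> j)))\<^sup>2 = (\<Sum>j\<in>{m..<n}. (a j)\<^sup>2)"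
        by (subst norm_minus_commute) (simp add: norm_orthonormal_combination[OF onb])
      also have "\<dots> < e\<^sup>2" using N[OF that(1), of n] by (simp add: sum_nonneg)
      finally show ?thesis using \<open>e > 0\<close> by (simp add: power_less_imp_less_base)
    qed
    then show "\<exists>M. \<forall>m\<ge>M. \<forall>n>m. dist (\<Sum>j<m. a j *\<^sub>R \<psi> j) (\<Sum>j<n. a j *\<^sub>R \<psi> j) < e"
      unfolding dist_norm by blast
  qed
  then have "convergent (\<lambda>n. \<Sum>j<n. a j *\<^sub>R \<psi> j)"
    by (rule Cauchy_convergent)
  then have "summable (\<lambda>j. a j *\<^sub>R \<psi> j)"
    by (simp add: summable_iff_convergent)
  then show ?thesis
    by (simp add: a_def spectral_power_def summable_sums)
qed

lemma inner_spectral_power_sums: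
  fixes \<psi> :: "nat \<Rightarrow> 'a::{real_inner, polish_space}"
  assumes "orthonormal_basis \<psi>" "decseq (\<lambda>j. lam j powr s)"
  shows "(\<lambda>j. lam j powr s * ((\<psi> j \<bullet> u) * (\<psi> j \<bullet> v))) sums (u \<bullet> spectral_power lam \<psi> s v)"
  using bounded_linear.sums[OF bounded_linear_inner_right spectral_power_sums[OF assms], of u v]
  by (simp add: inner_commute mult_ac)

lemma spectral_power_symmetric:
  fixes \<psi> :: "nat \<Rightarrow> 'a::{real_inner, polish_space}"
  assumes "orthonormal_basis \<psi>" "decseq (\<lambda>j. lam j powr s)"
  shows "u \<bullet> spectral_power lam \<psi> s v = spectral_power lam \<psi> s u \<bullet> v"
proof (rule sums_unique2[OF inner_spectral_power_sums[OF assms]])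
  show "(\<lambda>j. lam j powr s * ((\<psi> j \<bullet> u) * (\<psi> j \<bullet> v))) sums (spectral_power lam \<psi> s u \<bullet> v)"
    using inner_spectral_power_sums[OF assms, of v u] by (simp add: inner_commute mult_ac)
qed

lemma spectral_power_nonneg:
  fixes \<psi> :: "nat \<Rightarrow> 'a::{real_inner, polish_space}"
  assumes "orthonormal_basis \<psi>" "decseq (\<lambda>j. lam j powr s)"
  shows "0 \<le> v \<bullet> spectral_power lam \<psi> s v"
  using sums_le[OF _ sums_zero inner_spectral_power_sums[OF assms, of v v]] by simp

lemma spectral_power_linear:
  fixes \<psi> :: "nat \<Rightarrow> 'a::{real_inner, polish_space}"
  assumes "orthonormal_basis \<psi>" "decseq (\<lambda>j. lam j powr s)"
  shows "linear (spectral_power lam \<psi> s)"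
proof (rule linearI)
  note S = spectral_power_sums[OF assms]
  show "spectral_power lam \<psi> s (u + v) = spectral_power lam \<psi> s u + spectral_power lam \<psi> s v"
    for u v
    using sums_unique2[OF S[of "u + v"]] sums_add[OF S[of u] S[of v]]
    by (simp add: inner_add_right distrib_left scaleR_left_distrib)
  show "spectral_power lam \<psi> s (c *\<^sub>R v) = c *\<^sub>R spectral_power lam \<psi> s v" for c v
    using sums_unique2[OF S[of "c *\<^sub>R v"]] sums_scaleR_right[OF S[of v], of c]
    by (simp add: mult.left_commute)
qed

text \<open>
  On such \<open>v\<close> only the multipliers from index \<open>j\<close> on are seen, and they are at most the one at \<open>j\<close>.
\<close>

lemma spectral_power_le_on_orthogonal_complement:
  fixes \<psi> :: "nat \<Rightarrow> 'a::{real_inner, polish_space}"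
  assumes onb: "orthonormal_basis \<psi>" and dec: "decseq (\<lambda>j. lam j powr s)"
    and orth: "\<And>i. i < j \<Longrightarrow> \<psi> i \<bullet> v = 0"
  shows "v \<bullet> spectral_power lam \<psi> s v \<le> lam j powr s * (v \<bullet> v)"
proof -
  have le: "lam i powr s * ((\<psi> i \<bullet> v) * (\<psi> i \<bullet> v)) \<le> lam j powr s * (\<psi> i \<bullet> v)\<^sup>2" for i
    using orth[of i] decseqD[OF dec, of j i]
    by (cases "i < j") (auto simp: power2_eq_square intro!: mult_right_mono)
  have "v \<bullet> spectral_power lam \<psi> s v \<le> lam j powr s * (\<Sum>i. (\<psi> i \<bullet> v)\<^sup>2)"
    using sums_le[OF le inner_spectral_power_sums[OF onb dec]
        sums_mult[OF summable_sums[OF Bessel_inequality(1)[OF onb]]]] .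
  also have "\<dots> \<le> lam j powr s * (v \<bullet> v)"
    by (intro mult_left_mono Bessel_inequality(2)[OF onb]) simp
  finally show ?thesis .
qed

section \<open>Eigenvalue sequences\<close>

lemma finite_dimensional_basis:
  assumes "finite B" "V \<subseteq> span B"
  obtains C where "C \<subseteq> V" "finite C" "independent C" "V \<subseteq> span C" "card C = dim V"
proof -
  obtain C where C: "C \<subseteq> V" "independent C" "V \<subseteq> span C" "card C = dim V"
    using basis_exists by blast
  moreover have "finite C"
    using independent_span_bound[OF assms(1) C(2)] C(1) assms(2) by auto
  ultimately show ?thesis using that by blast
qed

lemma card_eigenvalue_sequence_vimage:
  assumes "eigenvalue_sequence T \<mu>" "finite X"
  shows "finite {i. \<mu> i \<in> X}" "card {i. \<mu> i \<in> X} = (\<Sum>x\<in>X. dim (eigenspace T x))"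
proof -
  have eq: "{i. \<mu> i \<in> X} = (\<Union>x\<in>X. {i. \<mu> i = x})" by auto
  show "finite {i. \<mu> i \<in> X}"
    using assms unfolding eq by (auto simp: eigenvalue_sequence_def)
  show "card {i. \<mu> i \<in> X} = (\<Sum>x\<in>X. dim (eigenspace T x))"
    unfolding eq using assms
    by (subst card_UN_disjoint) (auto simp: eigenvalue_sequence_def)
qed

text \<open>
  Among the first \<open>k + 1\<close> members of the independent family \<open>e\<close>, those with a given eigenvalue are no
  more than that eigenvalue has occurrences in \<open>\<mu>\<close>. Hence at least \<open>k + 1\<close> entries of \<open>\<mu>\<close> lie among
  the values \<open>\<nu> 0, \<dots>, \<nu> k\<close>, so one of them has index at least \<open>k\<close>; monotonicity does the rest.
  The family \<open>e\<close> may miss some eigenvectors of \<open>T\<close>.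
\<close>

lemma eigenvalue_sequence_ge:
  fixes e :: "nat \<Rightarrow> 'a::real_vector"
  assumes ev: "eigenvalue_sequence T \<mu>" and dec: "decseq \<nu>"
    and eig: "\<And>i. T (e i) = \<nu> i *\<^sub>R e i"
    and inj: "inj e" and indep: "\<And>S. independent (e ` S)"
  shows "\<nu> k \<le> \<mu> k"
proof -
  define X where "X = \<nu> ` {..k}"
  have le: "card {i. i \<le> k \<and> \<nu> i = x} \<le> dim (eigenspace T x)" for x
  proof -
    obtain B where "finite B" "eigenspace T x \<subseteq> span B"
      using ev by (auto simp: eigenvalue_sequence_def)
    then obtain C where C: "finite C" "eigenspace T x \<subseteq> span C" "card C = dim (eigenspace T x)"
      by (rule finite_dimensional_basis)
    have "e ` {i. i \<le> k \<and> \<nu> i = x} \<subseteq> eigenspace T x"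
      using eig by (auto simp: eigenspace_def)
    then have "card (e ` {i. i \<le> k \<and> \<nu> i = x}) \<le> card C"
      using independent_span_bound[OF C(1) indep] C(2) by blast
    then show ?thesis
      using C(3) inj by (simp add: card_image inj_on_subset)
  qed
  have "Suc k = card (\<Union>x\<in>X. {i. i \<le> k \<and> \<nu> i = x})"
  proof -
    have "(\<Union>x\<in>X. {i. i \<le> k \<and> \<nu> i = x}) = {..k}" by (auto simp: X_def)
    then show ?thesis by simp
  qed
  also have "\<dots> = (\<Sum>x\<in>X. card {i. i \<le> k \<and> \<nu> i = x})"
    by (rule card_UN_disjoint) (auto simp: X_def)
  also have "\<dots> \<le> card {i. \<mu> i \<in> X}"
    by (subst card_eigenvalue_sequence_vimage(2)[OF ev]) (auto simp: X_def intro: sum_mono le)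
  finally have "\<not> {i. \<mu> i \<in> X} \<subseteq> {..<k}"
    using card_mono[of "{..<k}" "{i. \<mu> i \<in> X}"] by auto
  then obtain i where "\<not> i < k" "\<mu> i \<in> X" by blast
  then have "k \<le> i" by simp
  have "\<nu> k \<le> \<mu> i" using \<open>\<mu> i \<in> X\<close> decseqD[OF dec] by (auto simp: X_def)
  also have "\<mu> i \<le> \<mu> k"
    using ev \<open>k \<le> i\<close> by (auto simp: eigenvalue_sequence_def dest: decseqD)
  finally show ?thesis .
qed

lemma eigenspace_orthogonal_basis:
  fixes T :: "'a::real_inner \<Rightarrow> 'a"
  assumes "linear T" and B: "finite B" "eigenspace T x \<subseteq> span B"
  obtains C where "C \<subseteq> eigenspace T x" "finite C" "0 \<notin> C" "pairwise orthogonal C"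
    "card C = dim (eigenspace T x)"
proof -
  have sub: "subspace (eigenspace T x)"
    using assms(1) by (auto simp: subspace_def eigenspace_def linear_0 linear_add linear_scale
        scaleR_right_distrib)
  obtain B' where B': "B' \<subseteq> eigenspace T x" "finite B'" "eigenspace T x \<subseteq> span B'"
    using B by (rule finite_dimensional_basis)
  obtain C where C: "finite C" "span C = span B'" "pairwise orthogonal C"
    using basis_orthogonal[OF B'(2)] by blast
  have sp: "span (C - {0}) = eigenspace T x"
    using C(2) B' sub by (metis span_delete_0 span_minimal subset_antisym)
  have po: "pairwise orthogonal (C - {0})"
    using C(3) by (rule pairwise_subset) auto
  have "card (C - {0}) = dim (span (C - {0}))"
    using dim_eq_card_independent[OF pairwise_orthogonal_independent[OF po]] by (simp del: span_delete_0)
  then show ?thesis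
    using that[of "C - {0}"] sp po C(1) span_superset[of "C - {0}"]
    by (simp del: span_delete_0)
qed

text \<open>
  The vectors are the union of orthogonal bases of the eigenspaces for the values
  \<open>\<mu> 0, \<dots>, \<mu> j\<close>. Different eigenspaces of a symmetric operator are orthogonal, so the dimensions
  add up to the number of entries of \<open>\<mu>\<close> with these values, which is at least \<open>j + 1\<close>.
\<close>

lemma orthogonal_eigenvectors:
  fixes T :: "'a::real_inner \<Rightarrow> 'a"
  assumes lin: "linear T" and sym: "\<And>u v. u \<bullet> T v = T u \<bullet> v"
    and ev: "eigenvalue_sequence T \<mu>"
  obtains C g where "finite C" "0 \<notin> C" "pairwise orthogonal C" "j < card C"
    "\<And>c. c \<in> C \<Longrightarrow> T c = g c *\<^sub>R c" "\<And>c. c \<in> C \<Longrightarrow> \<mu> j \<le> g c"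
proof -
  have "\<exists>C. C \<subseteq> eigenspace T x \<and> finite C \<and> 0 \<notin> C \<and> pairwise orthogonal C \<and>
            card C = dim (eigenspace T x)" for x
  proof -
    obtain B where "finite B" "eigenspace T x \<subseteq> span B"
      using ev by (auto simp: eigenvalue_sequence_def)
    then show ?thesis using eigenspace_orthogonal_basis[OF lin] by metis
  qed
  then obtain F where F: "\<And>x. F x \<subseteq> eigenspace T x" "\<And>x. finite (F x)" "\<And>x. 0 \<notin> F x"
    "\<And>x. pairwise orthogonal (F x)" "\<And>x. card (F x) = dim (eigenspace T x)"
    by metis
  have eig: "T c = x *\<^sub>R c" if "c \<in> F x" for c x
    using F(1) that by (auto simp: eigenspace_def)
  have orth: "c \<bullet> c' = 0" if "c \<in> F x" "c' \<in> F y" "x \<noteq> y" for c c' x y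
    using sym[of c c'] eig[OF that(1)] eig[OF that(2)] that(3) by simp
  define X where "X = \<mu> ` {..j}"
  define C where "C = (\<Union>x\<in>X. F x)"
  have fin: "finite X" "finite C" using F(2) by (auto simp: X_def C_def)
  have "card C = (\<Sum>x\<in>X. card (F x))"
    unfolding C_def
  proof (rule card_UN_disjoint)
    show "\<forall>x\<in>X. \<forall>y\<in>X. x \<noteq> y \<longrightarrow> F x \<inter> F y = {}"
      using orth F(3) by (metis disjoint_iff inner_eq_zero_iff)
  qed (use fin F(2) in auto)
  also have "\<dots> = card {i. \<mu> i \<in> X}"
    using card_eigenvalue_sequence_vimage(2)[OF ev fin(1)] F(5) by simp
  also have "\<dots> \<ge> card {..j}"
    using card_eigenvalue_sequence_vimage(1)[OF ev fin(1)]
    by (intro card_mono) (auto simp: X_def)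
  finally have card: "j < card C" by simp
  have "\<exists>x\<in>X. c \<in> F x" if "c \<in> C" for c using that by (auto simp: C_def)
  then obtain g where g: "\<And>c. c \<in> C \<Longrightarrow> g c \<in> X \<and> c \<in> F (g c)" by metis
  have po: "pairwise orthogonal C"
  proof (rule pairwiseI)
    fix c c' assume "c \<in> C" "c' \<in> C" "c \<noteq> c'"
    then show "orthogonal c c'"
      using g[of c] g[of c'] orth[of c "g c" c' "g c'"] F(4)[of "g c"]
      by (cases "g c = g c'") (auto simp: orthogonal_def pairwise_def)
  qed
  have "\<mu> j \<le> g c" if "c \<in> C" for c
    using g[OF that] ev by (auto simp: X_def eigenvalue_sequence_def dest: decseqD)
  moreover have "0 \<notin> C" using F(3) by (auto simp: C_def)
  ultimately show ?thesis
    using that[of C g] fin(2) po card g eig by blast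
qed

text \<open>
  The map \<open>f\<close> below sends the span of \<open>C\<close> into a space of dimension at most \<open>j\<close>, hence has a nonzero
  kernel vector \<open>v\<close>. Although the \<open>e i\<close> may be dependent, \<open>f v \<bullet> v\<close> is the sum of the squares
  \<open>(e i \<bullet> v)\<^sup>2\<close>, so each inner product vanishes.
\<close>

lemma exists_orthogonal_vector_in_span:
  fixes C :: "'a::real_inner set" and e :: "nat \<Rightarrow> 'a"
  assumes indep: "independent C" and C: "finite C" "j < card C"
  obtains v where "v \<in> span C" "v \<noteq> 0" "\<And>i. i < j \<Longrightarrow> e i \<bullet> v = 0"
proof -
  define f where "f v = (\<Sum>i<j. (e i \<bullet> v) *\<^sub>R e i)" for v
  have lin: "linear f"
    by (rule linearI)
       (simp_all add: f_def inner_add_right scaleR_left_distrib sum.distrib scaleR_sum_right)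
  have "\<not> inj_on f (span C)"
  proof
    assume inj: "inj_on f (span C)"
    have "independent (f ` C)"
      using linear_independent_injective_image[OF lin indep inj] .
    moreover have "f ` C \<subseteq> span (e ` {..<j})"
      by (auto simp: f_def intro!: span_sum span_scale intro: span_base)
    ultimately have "card (f ` C) \<le> card (e ` {..<j})"
      using independent_span_bound[of "e ` {..<j}" "f ` C"] by simp
    also have "\<dots> \<le> j" using card_image_le[of "{..<j}" e] by simp
    finally show False
      using C(2) inj_on_subset[OF inj span_superset] by (simp add: card_image)
  qed
  then obtain v where v: "v \<in> span C" "v \<noteq> 0" "f v = 0"
    using linear_inj_on_iff_eq_0[OF lin subspace_span] by metis
  have "e i \<bullet> v = 0" if "i < j" for i
  proof -
    have "(\<Sum>i<j. (e i \<bullet> v)\<^sup>2) = f v \<bullet> v"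
      by (simp add: f_def inner_sum_left power2_eq_square)
    then show ?thesis using v(3) that by (simp add: sum_nonneg_eq_0_iff)
  qed
  with v that show ?thesis by blast
qed

text \<open>
  The min-max upper bound. At the vector \<open>v\<close> that the preceding lemma finds in the span of \<open>j + 1\<close>
  leading eigenvectors, the form of \<open>T\<close> is at least \<open>\<mu> j * (v \<bullet> v)\<close>, since \<open>v\<close> expands
  orthogonally in eigenvectors whose eigenvalues are at least \<open>\<mu> j\<close>.
\<close>

lemma eigenvalue_sequence_le:
  fixes T :: "'a::real_inner \<Rightarrow> 'a" and e :: "nat \<Rightarrow> 'a"
  assumes lin: "linear T" and sym: "\<And>u v. u \<bullet> T v = T u \<bullet> v"
    and ev: "eigenvalue_sequence T \<mu>"
    and bound: "\<And>v. (\<And>i. i < j \<Longrightarrow> e i \<bullet> v = 0) \<Longrightarrow> v \<bullet> T v \<le> b * (v \<bullet> v)"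
  shows "\<mu> j \<le> b"
proof -
  obtain C g where C: "finite C" "0 \<notin> C" "pairwise orthogonal C" "j < card C"
    and eig: "\<And>c. c \<in> C \<Longrightarrow> T c = g c *\<^sub>R c" and ge: "\<And>c. c \<in> C \<Longrightarrow> \<mu> j \<le> g c"
    using orthogonal_eigenvectors[OF lin sym ev] by metis
  obtain v where v: "v \<in> span C" "v \<noteq> 0" "\<And>i. i < j \<Longrightarrow> e i \<bullet> v = 0"
    using exists_orthogonal_vector_in_span[OF pairwise_orthogonal_independent[OF C(3,2)] C(1,4)]
    by metis
  obtain a where a: "v = (\<Sum>c\<in>C. a c *\<^sub>R c)"
    using v(1) span_finite[OF C(1)] by auto
  have orth: "c' \<bullet> c = 0" if "c \<in> C" "c' \<in> C" "c' \<noteq> c" for c c'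
    using C(3) that by (auto simp: pairwise_def orthogonal_def)
  have diag: "v \<bullet> (\<Sum>c\<in>C. h c *\<^sub>R c) = (\<Sum>c\<in>C. a c * h c * (c \<bullet> c))" for h
  proof -
    have "v \<bullet> (\<Sum>c\<in>C. h c *\<^sub>R c) = (\<Sum>c\<in>C. \<Sum>c'\<in>C. h c * (a c' * (c' \<bullet> c)))"
      unfolding a by (simp add: inner_sum_left inner_sum_right sum_distrib_left)
    also have "\<dots> = (\<Sum>c\<in>C. \<Sum>c'\<in>C. if c' = c then a c * h c * (c \<bullet> c) else 0)"
      by (intro sum.cong refl) (auto simp: orth)
    also have "\<dots> = (\<Sum>c\<in>C. a c * h c * (c \<bullet> c))" using C(1) by simp
    finally show ?thesis .
  qed
  have "T v = (\<Sum>c\<in>C. (a c * g c) *\<^sub>R c)"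
    unfolding a by (simp add: linear_sum[OF lin] linear_scale[OF lin] eig)
  then have "v \<bullet> T v = (\<Sum>c\<in>C. g c * ((a c)\<^sup>2 * (c \<bullet> c)))"
    by (simp add: diag power2_eq_square mult_ac)
  also have "\<dots> \<ge> (\<Sum>c\<in>C. \<mu> j * ((a c)\<^sup>2 * (c \<bullet> c)))"
    by (intro sum_mono mult_right_mono ge) auto
  also have "(\<Sum>c\<in>C. \<mu> j * ((a c)\<^sup>2 * (c \<bullet> c))) = \<mu> j * (v \<bullet> v)"
    using diag[of a] by (simp add: sum_distrib_left power2_eq_square mult_ac flip: a)
  finally have "\<mu> j * (v \<bullet> v) \<le> b * (v \<bullet> v)" using bound[OF v(3)] by linarith
  then show ?thesis using v(2) by simp
qed

lemma eigenvalue_sequence_nonneg: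
  fixes T :: "'a::real_inner \<Rightarrow> 'a"
  assumes "eigenvalue_sequence T \<mu>" "positive_semidefinite T"
  shows "0 \<le> \<mu> j"
proof -
  have "finite {i. \<mu> i = \<mu> j}" "card {i. \<mu> i = \<mu> j} = dim (eigenspace T (\<mu> j))"
    using assms(1) by (auto simp: eigenvalue_sequence_def)
  moreover have "j \<in> {i. \<mu> i = \<mu> j}" by simp
  ultimately have "dim (eigenspace T (\<mu> j)) \<noteq> 0"
    using card_0_eq by (metis empty_iff)
  moreover have "dim {0 :: 'a} = 0"
    using dim_span[of "{} :: 'a set"] dim_eq_card_independent[OF independent_empty] by simp
  ultimately have "\<not> eigenspace T (\<mu> j) \<subseteq> {0}"
    by (metis dim_eq_card_independent card.empty independent_empty subset_singletonD)
  then obtain v where v: "v \<noteq> 0" "T v = \<mu> j *\<^sub>R v" by (auto simp: eigenspace_def)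
  have "0 \<le> v \<bullet> T v" using assms(2) by (simp add: positive_semidefinite_def)
  moreover have "0 < v \<bullet> v" using v(1) by simp
  ultimately show ?thesis using v(2) by (simp add: zero_le_mult_iff)
qed

section \<open>Form comparison of prior and posterior\<close>

text \<open>
  With \<open>z v\<close> a preimage of \<open>C1 v\<close> under \<open>C0\<close>, the equation \<open>v = H (C1 v) + z v\<close> expresses the form
  of \<open>C1\<close> as a sum of a form of \<open>H\<close> and one of \<open>C0\<close>, which gives symmetry and positivity. Moreover
  it gives \<open>z v \<bullet> C0 (z v) \<le> v \<bullet> C1 v\<close>. Expanding the nonnegative number
  \<open>(v - z v) \<bullet> C0 (v - z v)\<close>, whose mixed terms are both \<open>- (v \<bullet> C1 v)\<close>, then yields the comparison.
\<close>

lemma posterior_covariance: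
  fixes C0 C1 H :: "'a::real_inner \<Rightarrow> 'a"
  assumes lin0: "linear C0" and sym0: "\<And>u v. u \<bullet> C0 v = C0 u \<bullet> v"
    and psd0: "positive_semidefinite C0"
    and symH: "\<And>u v. u \<bullet> H v = H u \<bullet> v" and psdH: "positive_semidefinite H"
    and inv: "bounded_inverse (range C0) (\<lambda>u. H u + inv C0 u) C1"
  shows "u \<bullet> C1 v = C1 u \<bullet> v" and "positive_semidefinite C1" and "v \<bullet> C1 v \<le> v \<bullet> C0 v"
proof -
  define z where "z v = inv C0 (C1 v)" for v
  have z: "C0 (z v) = C1 v" "H (C1 v) + z v = v" for v
    using inv by (auto simp: z_def bounded_inverse_def f_inv_into_f)
  have form: "u \<bullet> C1 v = H (C1 u) \<bullet> C1 v + z u \<bullet> C0 (z v)" for u v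
    by (metis inner_add_left z)
  show "u \<bullet> C1 v = C1 u \<bullet> v"
    using form[of u v] form[of v u] symH[of "C1 u" "C1 v"] sym0[of "z u" "z v"]
    by (simp add: inner_commute)
  have nnH: "0 \<le> H w \<bullet> w" for w
    using psdH by (simp add: positive_semidefinite_def inner_commute)
  have nn0: "0 \<le> w \<bullet> C0 w" for w
    using psd0 by (simp add: positive_semidefinite_def)
  show "positive_semidefinite C1"
    unfolding positive_semidefinite_def
  proof
    show "0 \<le> v \<bullet> C1 v" for v
      using form[of v v] nnH[of "C1 v"] nn0[of "z v"] by linarith
  qed
  have "0 \<le> (v - z v) \<bullet> C0 (v - z v)" by (rule nn0)
  also have "\<dots> = v \<bullet> C0 v - 2 * (v \<bullet> C1 v) + z v \<bullet> C0 (z v)"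
    using sym0[of "z v" v] by (simp add: linear_diff[OF lin0] inner_diff z inner_commute)
  also have "\<dots> \<le> v \<bullet> C0 v - v \<bullet> C1 v"
    using form[of v v] nnH[of "C1 v"] by simp
  finally show "v \<bullet> C1 v \<le> v \<bullet> C0 v" by simp
qed

section \<open>Eigenvalues of the posterior covariance\<close>

theorem lemma4p2:
  fixes d :: nat and \<alpha> :: real
    and dom_A :: "'a::{real_inner, polish_space} set"
    and A H C0 C1 :: "'a \<Rightarrow> 'a"
    and lam \<mu>0 \<mu>1 :: "nat \<Rightarrow> real" and \<psi> :: "nat \<Rightarrow> 'a"
  assumes "\<not> (\<exists>B :: 'a set. finite B \<and> span B = UNIV)"
    and "d \<in> {1, 2, 3}"
    and "laplacian_like d dom_A A lam \<psi>"
    and "\<alpha> > real d / 2"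
    and "C0 = spectral_power lam \<psi> (- \<alpha>)"
    and "bounded_linear H" and "self_adjoint UNIV H"
    and "bounded_inverse (range C0) (\<lambda>u. H u + inv C0 u) C1"
    and "eigenvalue_sequence C0 \<mu>0" and "eigenvalue_sequence C1 \<mu>1"
    and "positive_semidefinite H"
  shows "(\<forall>j. 0 \<le> \<mu>1 j \<and> \<mu>1 j \<le> \<mu>0 j) \<and>
         (\<forall>q :: real. q > real d / (2 * \<alpha>) \<longrightarrow> summable (\<lambda>j. \<bar>\<mu>1 j\<bar> powr q))"
proof -
  note C0 = assms(5)
  have d: "real d > 0" using assms(2) by auto
  then have \<alpha>: "\<alpha> > 0" using assms(4) by (smt (verit) divide_pos_pos)
  have onb: "orthonormal_basis \<psi>" and inc: "incseq lam"
    using assms(3) by (auto simp: laplacian_like_def)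
  obtain c where c: "c > 0" "\<And>j. c * real (Suc j) powr (2 / real d) \<le> lam j"
    using assms(3) by (auto simp: laplacian_like_def)
  have pos: "0 < lam j" for j
    using c(1) by (intro less_le_trans[OF _ c(2)]) simp
  have dec: "decseq (\<lambda>j. lam j powr (- \<alpha>))"
    using incseqD[OF inc] pos \<alpha> by (auto simp: decseq_def intro!: powr_mono2')
  have psd0: "positive_semidefinite C0"
    unfolding C0 positive_semidefinite_def using spectral_power_nonneg[OF onb dec] by blast
  have symH: "u \<bullet> H v = H u \<bullet> v" for u v
    using assms(7) unfolding self_adjoint_def by (metis UNIV_I)
  note post = posterior_covariance[OF spectral_power_linear[OF onb dec]
      spectral_power_symmetric[OF onb dec] _ symH assms(11),
      folded C0, OF psd0 assms(8)]
  have lin1: "linear C1"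
    using assms(8) by (auto simp: bounded_inverse_def bounded_linear.linear)
  have le: "\<mu>1 j \<le> lam j powr (- \<alpha>)" for j
  proof (rule eigenvalue_sequence_le[OF lin1 post(1) assms(10)])
    fix v assume "\<And>i. i < j \<Longrightarrow> \<psi> i \<bullet> v = 0"
    then show "v \<bullet> C1 v \<le> lam j powr (- \<alpha>) * (v \<bullet> v)"
      using spectral_power_le_on_orthogonal_complement[OF onb dec] post(3)[of v]
      unfolding C0 by (metis order_trans)
  qed
  have ge: "lam j powr (- \<alpha>) \<le> \<mu>0 j" for j
    by (rule eigenvalue_sequence_ge[OF assms(9) dec _ orthonormal_basis_inj[OF onb]
          orthonormal_basis_independent[OF onb]])
       (simp add: C0 spectral_power_basis[OF onb])
  have nn: "0 \<le> \<mu>1 j" for j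
    by (rule eigenvalue_sequence_nonneg[OF assms(10) post(2)])
  have "summable (\<lambda>j. \<bar>\<mu>1 j\<bar> powr q)" if q: "q > real d / (2 * \<alpha>)" for q
  proof -
    have q0: "q > 0" using q d \<alpha> by (smt (verit) divide_pos_pos)
    define p where "p = - (2 / real d * \<alpha> * q)"
    have "p < -1" using q d \<alpha> by (simp add: p_def field_simps)
    then have "summable (\<lambda>j. real j powr p)" by (simp add: summable_real_powr_iff)
    then have maj: "summable (\<lambda>j. c powr (- \<alpha> * q) * real (Suc j) powr p)"
      by (intro summable_mult) (subst summable_Suc_iff)
    have "\<bar>\<mu>1 j\<bar> powr q \<le> c powr (- \<alpha> * q) * real (Suc j) powr p" for j
    proof -
      have "\<bar>\<mu>1 j\<bar> powr q \<le> (lam j powr (- \<alpha>)) powr q"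
        using nn[of j] le[of j] q0 by (intro powr_mono2) auto
      also have "\<dots> = lam j powr (- \<alpha> * q)" by (simp add: powr_powr)
      also have "\<dots> \<le> (c * real (Suc j) powr (2 / real d)) powr (- \<alpha> * q)"
        using c(1) c(2)[of j] \<alpha> q0 by (intro powr_mono2') auto
      also have "\<dots> = c powr (- \<alpha> * q) * real (Suc j) powr p"
        using c(1) by (simp add: powr_mult powr_powr p_def mult.assoc)
      finally show ?thesis .
    qed
    then have "norm (\<bar>\<mu>1 j\<bar> powr q) \<le> c powr (- \<alpha> * q) * real (Suc j) powr p" for j
      by (simp del: of_nat_Suc)
    then show ?thesis
      by (rule summable_comparison_test'[OF maj])
  qed
  moreover have "\<mu>1 j \<le> \<mu>0 j" for j using le[of j] ge[of j] by linarith
  ultimately show ?thesis using nn by blast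
qed

end
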